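(* Let $a\in C^1([-1,1])$ with $a>0$ on $(-1,1)$ and $a(-1)=a(1)=0$, and let $\xi_a(x)=\int_0^x\frac{ds}{a(s)}$. Let $T>0$ and $Q_T=(0,T)\times(-1,1)$. If $\xi_a\in L^{\frac{1+\vartheta}{3-\vartheta}}(-1,1)$ for some $\vartheta\in[1,3)$, then $$\mathcal B(Q_T)\subset L^{1+\vartheta}(Q_T),$$ and there is a positive constant $c$ such that for all $u\in\mathcal B(Q_T)$ $$\|u\|_{L^{1+\vartheta}(Q_T)}\le c\,T^{\frac{3-\vartheta}{4(1+\vartheta)}}\|u\|_{\mathcal B(Q_T)} .$$
   Context: $H^1_a(-1,1)=\{u\in L^2(-1,1): u$ is locally absolutely continuous in $(-1,1)$ and $\sqrt a\,u_x\in L^2(-1,1)\}$, with norm $\|u\|_{1,a}^2=\|u\|_{L^2(-1,1)}^2+\|\sqrt a\,u_x\|_{L^2(-1,1)}^2$. $\mathcal B(Q_T)=C([0,T];L^2(-1,1))\cap L^2(0,T;H^1_a(-1,1))$ with norm $\|u\|_{\mathcal B(Q_T)}^2=\sup_{t\in[0,T]}\|u(t,\cdot)\|_{L^2(-1,1)}^2+2\int_0^T\int_{-1}^1a(x)u_x^2\,dx\,dt$. The constant $c$ is chosen after $T$, $a$ and $\vartheta$ are fixed, and does not depend on $u$. *)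

theory Defs
  imports "HOL-Analysis.Analysis"
begin

text \<open>
  Elements of Lebesgue spaces are represented by functions, not by classes modulo null sets.
  Membership in \<open>Lp\<close> and \<open>H1a\<close> and the norms do not depend on the representative.
\<close>

definition Lp :: "real \<Rightarrow> 'a measure \<Rightarrow> ('a \<Rightarrow> real) set" where
  "Lp p M = {f \<in> borel_measurable M. integrable M (\<lambda>x. \<bar>f x\<bar> powr p)}"

definition Lp_norm :: "real \<Rightarrow> 'a measure \<Rightarrow> ('a \<Rightarrow> real) \<Rightarrow> real" where
  "Lp_norm p M f = (LINT x|M. \<bar>f x\<bar> powr p) powr (1 / p)"

abbreviation leb_I :: "real measure" where
  "leb_I \<equiv> lebesgue_on {-1<..<1}"

definition C1_on :: "real set \<Rightarrow> (real \<Rightarrow> real) \<Rightarrow> bool" where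
  "C1_on S f \<longleftrightarrow>
     (\<exists>f'. (\<forall>x\<in>S. (f has_real_derivative f' x) (at x within S)) \<and> continuous_on S f')"

definition abs_cont_on :: "real \<Rightarrow> real \<Rightarrow> (real \<Rightarrow> real) \<Rightarrow> bool" where
  "abs_cont_on c d v \<longleftrightarrow>
     (\<forall>\<epsilon>>0. \<exists>\<delta>>0. \<forall>D :: (real \<times> real) set.
        finite D \<and> (\<forall>(x, y)\<in>D. c \<le> x \<and> x < y \<and> y \<le> d) \<and>
        pairwise (\<lambda>p q. {fst p<..<snd p} \<inter> {fst q<..<snd q} = {}) D \<and>
        (\<Sum>(x, y)\<in>D. y - x) < \<delta>
        \<longrightarrow> (\<Sum>(x, y)\<in>D. \<bar>v y - v x\<bar>) < \<epsilon>)"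

definition loc_abs_cont :: "(real \<Rightarrow> real) \<Rightarrow> bool" where
  "loc_abs_cont v \<longleftrightarrow> (\<forall>c d. -1 < c \<and> c \<le> d \<and> d < 1 \<longrightarrow> abs_cont_on c d v)"

text \<open>
  \<open>is_x_deriv u g\<close>: the class of \<open>u\<close> has a representative that is locally absolutely continuous
  in \<open>(-1, 1)\<close>, and \<open>g\<close> is its almost everywhere defined derivative. The representative is
  unique on \<open>(-1, 1)\<close>, so \<open>g\<close> is unique up to a null set.
\<close>

definition is_x_deriv :: "(real \<Rightarrow> real) \<Rightarrow> (real \<Rightarrow> real) \<Rightarrow> bool" where
  "is_x_deriv u g \<longleftrightarrow>
     (\<exists>v. (AE x in leb_I. v x = u x) \<and> loc_abs_cont v \<and>
          (AE x in leb_I. (v has_real_derivative g x) (at x)))"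

definition x_deriv :: "(real \<Rightarrow> real) \<Rightarrow> real \<Rightarrow> real" where
  "x_deriv u = (SOME g. is_x_deriv u g)"

definition H1a :: "(real \<Rightarrow> real) \<Rightarrow> (real \<Rightarrow> real) set" where
  "H1a a = {u \<in> Lp 2 leb_I.
     (\<exists>g. is_x_deriv u g) \<and> (\<lambda>x. sqrt (a x) * x_deriv u x) \<in> Lp 2 leb_I}"

definition H1a_norm :: "(real \<Rightarrow> real) \<Rightarrow> (real \<Rightarrow> real) \<Rightarrow> real" where
  "H1a_norm a u =
     sqrt ((Lp_norm 2 leb_I u)\<^sup>2 + (Lp_norm 2 leb_I (\<lambda>x. sqrt (a x) * x_deriv u x))\<^sup>2)"

definition Q :: "real \<Rightarrow> (real \<times> real) set" where
  "Q T = {0<..<T} \<times> {-1<..<1}"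

text \<open>
  A function \<open>u\<close> of \<open>(t, x)\<close> stands for the curve of its time slices \<open>t \<mapsto> u (t, \<cdot>)\<close>.
\<close>

definition C_L2 :: "real \<Rightarrow> (real \<times> real \<Rightarrow> real) set" where
  "C_L2 T = {u. (\<forall>t\<in>{0..T}. (\<lambda>x. u (t, x)) \<in> Lp 2 leb_I) \<and>
     (\<forall>t\<in>{0..T}.
        ((\<lambda>s. Lp_norm 2 leb_I (\<lambda>x. u (s, x) - u (t, x))) \<longlongrightarrow> 0) (at t within {0..T}))}"

text \<open>
  The Bochner space \<open>L\<^sup>2(0, T; H1a)\<close>: the slices are almost everywhere limits, in the norm of
  \<open>H1a\<close>, of \<open>H1a\<close>-valued simple functions \<open>s n\<close>, and the squared norm is integrable.
\<close>

definition L2_H1a :: "(real \<Rightarrow> real) \<Rightarrow> real \<Rightarrow> (real \<times> real \<Rightarrow> real) set" where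
  "L2_H1a a T = {u.
     (AE t in lebesgue_on {0<..<T}. (\<lambda>x. u (t, x)) \<in> H1a a) \<and>
     (\<exists>s :: nat \<Rightarrow> real \<Rightarrow> (real \<Rightarrow> real).
        (\<forall>n. simple_function (lebesgue_on {0<..<T}) (s n) \<and> s n ` {0<..<T} \<subseteq> H1a a) \<and>
        (AE t in lebesgue_on {0<..<T}.
           (\<lambda>n. H1a_norm a (\<lambda>x. s n t x - u (t, x))) \<longlonglongrightarrow> 0)) \<and>
     integrable (lebesgue_on {0<..<T}) (\<lambda>t. (H1a_norm a (\<lambda>x. u (t, x)))\<^sup>2)}"

text \<open>
  Joint measurability is part of the representation: every class in \<open>C([0, T]; L\<^sup>2(-1, 1))\<close> has a
  jointly measurable representative, but slices may be altered on null sets depending on \<open>t\<close> in a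
  way that destroys it, and only jointly measurable functions represent elements of
  Lebesgue spaces over \<open>Q T\<close>.
\<close>

definition B :: "(real \<Rightarrow> real) \<Rightarrow> real \<Rightarrow> (real \<times> real \<Rightarrow> real) set" where
  "B a T = {u \<in> borel_measurable (lebesgue_on (Q T)). u \<in> C_L2 T \<and> u \<in> L2_H1a a T}"

definition B_norm :: "(real \<Rightarrow> real) \<Rightarrow> real \<Rightarrow> (real \<times> real \<Rightarrow> real) \<Rightarrow> real" where
  "B_norm a T u = sqrt
     ((SUP t\<in>{0..T}. (Lp_norm 2 leb_I (\<lambda>x. u (t, x)))\<^sup>2) +
      2 * (LINT t|lebesgue_on {0<..<T}. LINT x|leb_I. a x * (x_deriv (\<lambda>y. u (t, y)) x)\<^sup>2))"

definition xi :: "(real \<Rightarrow> real) \<Rightarrow> real \<Rightarrow> real" where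
  "xi a x = (LBINT s=0..x. 1 / a s)"

end

(*
  Write W = |xi_a| + K + 1 >= 1 with K >= |xi_a| on [-1/2, 1/2], D = ||sqrt(a) u_x||^2 and p = 1 + theta.
  By Cauchy-Schwarz, |u(x) - u(y)|^2 <= |xi_a(x) - xi_a(y)| D on a time slice, and averaging over
  y in [-1/2, 1/2] gives u(x)^2 <= 2 ||u||^2 + 2 W(x) D. Using this for only two of the p factors,
  |u|^p <= 2 |u|^(p-2) W (M^2 + D) with M >= ||u||, which keeps D to the first power, so that it is
  integrable in time. The weight |u|^(p-2) W is absorbed by Young's inequality into
  u^2 and W^(p/(4-p)), and p/(4-p) is the exponent in the hypothesis on xi_a.
*)
theory Submission
  imports Defs
begin

text \<open>A boundary point cannot serve as the reference point y of the pointwise bound: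
  \<open>a\<close> is C^1 and vanishes at both ends, so \<open>xi a\<close> is unbounded near each
  of them, and slices need not have boundary values. Hence the average over an interior interval,
  whose length 1 adds no factor. The derivative in \<open>H1a\<close> exists only almost everywhere.
  Increments of a slice are recovered from it by the fundamental theorem of calculus for absolutely
  continuous functions, in gauge form. The range of theta enters through p: theta >= 1 keeps the
  exponent p - 2 nonnegative, and theta < 3 keeps 4 - p positive. The Young step is not homogeneous
  in u, so u is first divided by a number M > 0. The norm in \<open>B a T\<close> can be 0, so M
  runs through all numbers above it and is lowered to the norm only at the end.\<close>

section \<open>Fundamental theorem of calculus for absolutely continuous functions\<close>

text \<open>
  The gauge at a point of \<open>E\<close> is a ball inside an open \<open>G \<supseteq> E\<close> of small measure, so that absolute
  continuity bounds the increments over the intervals tagged there. Elsewhere the gauge comes from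
  differentiability.
\<close>

lemma abs_cont_on_integral:
  fixes v g :: "real \<Rightarrow> real"
  assumes "c \<le> d" and ac: "abs_cont_on c d v" and E: "negligible E"
    and deriv: "\<And>x. x \<in> {c..d} - E \<Longrightarrow> (v has_real_derivative g x) (at x within {c..d})"
  shows "(g has_integral v d - v c) {c..d}"
proof -
  \<comment> \<open>Zero on \<open>E\<close>, so that tags in \<open>E\<close> add nothing to the
    Riemann sum and only the increments of \<open>v\<close> must be controlled there. Changing
    values on a negligible set restores \<open>g\<close> at the end.\<close>
  define h where "h x = (if x \<in> E then 0 else g x)" for x
  have "(h has_integral v d - v c) {c..d}"
    unfolding has_integral_factor_content box_real[symmetric]
  proof safe
    fix e0 :: real
    assume "e0 > 0"
    show "\<exists>\<gamma>. gauge \<gamma> \<and> (\<forall>p. p tagged_division_of (cbox c d) \<and> \<gamma> fine p \<longrightarrow>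
       norm ((\<Sum>(x, k)\<in>p. measure lborel k *\<^sub>R h x) - (v d - v c)) \<le> e0 * measure lborel (cbox c d))"
    proof (cases "c = d")
      case True
      have "gauge (\<lambda>x::real. ball x 1)" by auto
      moreover have "norm ((\<Sum>(x, k)\<in>p. measure lborel k *\<^sub>R h x) - (v d - v c)) \<le> e0 * measure lborel (cbox c d)"
        if "p tagged_division_of (cbox c d)" for p
        using sum_content_null[OF _ that, of h] True by simp
      ultimately show ?thesis by (intro exI[of _ "\<lambda>x. ball x 1"]) simp
    next
      case False
      with \<open>c \<le> d\<close> have "c < d" by simp
      \<comment> \<open>Half of the tolerance goes to the tags in \<open>E\<close>, half to the
        others.\<close>
      define e where "e = e0 / 2"
      have "e > 0" using \<open>e0 > 0\<close> by (simp add: e_def)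
      have pos: "e * (d - c) > 0" using \<open>e > 0\<close> \<open>c < d\<close> by simp
      obtain \<delta> where "\<delta> > 0" and \<delta>: "\<forall>D :: (real \<times> real) set.
        finite D \<and> (\<forall>(x, y)\<in>D. c \<le> x \<and> x < y \<and> y \<le> d) \<and>
        pairwise (\<lambda>p q. {fst p<..<snd p} \<inter> {fst q<..<snd q} = {}) D \<and>
        (\<Sum>(x, y)\<in>D. y - x) < \<delta>
        \<longrightarrow> (\<Sum>(x, y)\<in>D. \<bar>v y - v x\<bar>) < e * (d - c)"
        using mp[OF spec[OF ac[unfolded abs_cont_on_def]] pos] by (elim exE conjE)
      have "E \<in> sets lebesgue" "emeasure lebesgue E = 0"
        using E by (auto simp: negligible_iff_null_sets)
      then obtain G where G: "open G" "E \<subseteq> G" "emeasure lebesgue (G - E) < ennreal \<delta>"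
        using sets_lebesgue_outer_open[OF \<open>E \<in> sets lebesgue\<close> \<open>\<delta> > 0\<close>] by metis
      have "emeasure lebesgue G = emeasure lebesgue ((G - E) \<union> E)"
        using G(2) by (simp add: Un_absorb2)
      also have "\<dots> \<le> emeasure lebesgue (G - E) + emeasure lebesgue E"
        using G(1) \<open>E \<in> sets lebesgue\<close> by (intro emeasure_subadditive) auto
      finally have Gm: "emeasure lebesgue G < ennreal \<delta>"
        using G(3) \<open>emeasure lebesgue E = 0\<close> by simp
      have "\<exists>r>0. ball x r \<subseteq> G" if "x \<in> E" for x
        using G that by (meson in_mono openE)
      moreover have "\<exists>r>0. \<forall>y\<in>{c..d}. norm (y - x) < r \<longrightarrow>
          norm (v y - v x - (y - x) * g x) \<le> e * norm (y - x)" if "x \<in> {c..d} - E" for x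
        using deriv[OF that] \<open>e > 0\<close>
        unfolding has_field_derivative_def has_derivative_within_alt
        by (auto simp: mult.commute)
      ultimately have "\<forall>x. \<exists>r>0. (x \<in> E \<longrightarrow> ball x r \<subseteq> G) \<and> (x \<in> {c..d} - E \<longrightarrow> 
          (\<forall>y\<in>{c..d}. norm (y - x) < r \<longrightarrow> norm (v y - v x - (y - x) * g x) \<le> e * norm (y - x)))"
        by (metis DiffD2 zero_less_one)
      then obtain r where r: "\<And>x. r x > 0" "\<And>x. x \<in> E \<Longrightarrow> ball x (r x) \<subseteq> G"
        "\<And>x y. x \<in> {c..d} - E \<Longrightarrow> y \<in> {c..d} \<Longrightarrow> norm (y - x) < r x \<Longrightarrow>
            norm (v y - v x - (y - x) * g x) \<le> e * norm (y - x)"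
        by metis
      have "norm ((\<Sum>(x, k)\<in>p. measure lborel k *\<^sub>R h x) - (v d - v c)) \<le> e0 * measure lborel (cbox c d)"
        if ptag: "p tagged_division_of (cbox c d)" and fine: "(\<lambda>x. ball x (r x)) fine p" for p
      proof -
        have "finite p" using ptag by blast
        have K: "\<exists>a b. K = {a..b} \<and> Inf K = a \<and> Sup K = b \<and> a \<le> x \<and> x \<le> b \<and> c \<le> a \<and> b \<le> d \<and> {a..b} \<subseteq> ball x (r x)"
          if "(x, K) \<in> p" for x K
        proof -
          obtain a b where ab: "K = cbox a b"
            using tagged_division_ofD(4)[OF ptag \<open>(x, K) \<in> p\<close>] by blast
          have xK: "x \<in> K" and Kcd: "K \<subseteq> cbox c d"
            using tagged_division_ofD(2,3)[OF ptag that] by auto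
          have "K \<subseteq> ball x (r x)" using fine that unfolding fine_def by fast
          moreover have "a \<le> x" "x \<le> b" using xK ab by auto
          moreover from this have "a \<in> K" "b \<in> K" using ab by auto
          then have "c \<le> a" "b \<le> d" using Kcd by auto
          ultimately show ?thesis using ab by (intro exI[of _ a] exI[of _ b]) simp
        qed
        \<comment> \<open>\<open>abs_cont_on\<close> speaks of nondegenerate intervals given by
          their end points. Dropping the degenerate ones loses nothing, as \<open>v\<close> has no
          increment there, and makes \<open>ends\<close> injective: two nondegenerate intervals with
          the same ends would overlap.\<close>
        define p' where "p' = {(x, K) \<in> p. x \<in> E \<and> Inf K < Sup K}"
        define ends where "ends = (\<lambda>(x::real, K::real set). (Inf K, Sup K))"
        have "p' \<subseteq> p" by (auto simp: p'_def)
        then have "finite p'" using \<open>finite p\<close> finite_subset by blast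
        have disj: "{Inf K<..<Sup K} \<inter> {Inf L<..<Sup L} = {}" if "(x, K) \<in> p" "(y, L) \<in> p" "(x, K) \<noteq> (y, L)" for x y K L
        proof -
          have "interior K \<inter> interior L = {}"
            using tagged_division_ofD(5)[OF ptag that] .
          moreover obtain a b where "K = {a..b}" "Inf K = a" "Sup K = b" using K[OF \<open>(x, K) \<in> p\<close>] by blast
          moreover obtain a' b' where "L = {a'..b'}" "Inf L = a'" "Sup L = b'" using K[OF \<open>(y, L) \<in> p\<close>] by blast
          ultimately show ?thesis by (simp add: interior_atLeastAtMost_real)
        qed
        have inj: "inj_on ends p'"
        proof (rule inj_onI)
          fix s t assume st: "s \<in> p'" "t \<in> p'" "ends s = ends t"
          obtain x K y L where eq: "s = (x, K)" "t = (y, L)" by (metis surj_pair)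
          show "s = t"
          proof (rule ccontr)
            assume "s \<noteq> t"
            then have "{Inf K<..<Sup K} \<inter> {Inf L<..<Sup L} = {}"
              using disj st eq \<open>p' \<subseteq> p\<close> by blast
            moreover have "Inf L = Inf K" "Sup L = Sup K" "Inf K < Sup K"
              using st eq by (auto simp: ends_def p'_def)
            ultimately show False by (simp add: greaterThanLessThan_empty_iff)
          qed
        qed
        define D where "D = ends ` p'"
        have "finite D" using \<open>finite p'\<close> by (simp add: D_def)
        have D1: "\<forall>(x, y)\<in>D. c \<le> x \<and> x < y \<and> y \<le> d"
          using K by (fastforce simp: D_def ends_def p'_def)
        have D2: "pairwise (\<lambda>p q. {fst p<..<snd p} \<inter> {fst q<..<snd q} = {}) D"
        proof (rule pairwiseI)
          fix s t assume "s \<in> D" "t \<in> D" "s \<noteq> t"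
          then obtain x K y L where *: "(x, K) \<in> p" "(y, L) \<in> p" "s = (Inf K, Sup K)" "t = (Inf L, Sup L)"
            using \<open>p' \<subseteq> p\<close> by (auto simp: D_def ends_def p'_def)
          with \<open>s \<noteq> t\<close> have "(x, K) \<noteq> (y, L)" by auto
          from disj[OF *(1,2) this] show "{fst s<..<snd s} \<inter> {fst t<..<snd t} = {}" using * by simp
        qed
        have DG: "{fst q<..<snd q} \<subseteq> G" if "q \<in> D" for q
        proof -
          obtain x K where xK: "(x, K) \<in> p" "x \<in> E" "q = (Inf K, Sup K)"
            using \<open>q \<in> D\<close> by (auto simp: D_def ends_def p'_def)
          then show ?thesis using K[OF xK(1)] r(2)[OF xK(2)] by fastforce
        qed
        have "ennreal (\<Sum>(x, y)\<in>D. y - x) = (\<Sum>q\<in>D. ennreal (snd q - fst q))"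
          using D1 by (subst sum_ennreal) (auto simp: case_prod_beta intro: less_imp_le)
        also have "\<dots> = (\<Sum>q\<in>D. emeasure lebesgue {fst q<..<snd q})"
          using D1 by (intro sum.cong) (auto intro: less_imp_le)
        also have "\<dots> = emeasure lebesgue (\<Union>q\<in>D. {fst q<..<snd q})"
          using \<open>finite D\<close> D2 by (intro sum_emeasure) (auto simp: disjoint_family_on_def pairwise_def)
        also have "\<dots> \<le> emeasure lebesgue G"
          using DG G(1) by (intro emeasure_mono) auto
        also have "\<dots> < ennreal \<delta>" by (rule Gm)
        finally have D3: "(\<Sum>(x, y)\<in>D. y - x) < \<delta>"
          using \<open>\<delta> > 0\<close> by (simp add: ennreal_less_iff[OF sum_nonneg] ennreal_less_iff ennreal_lessI split: prod.splits)
             (meson ennreal_leI linorder_not_less)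
        have small: "(\<Sum>(x, y)\<in>D. \<bar>v y - v x\<bar>) < e * (d - c)"
          using \<open>finite D\<close> D1 D2 D3 by (intro mp[OF spec[OF \<delta>]] conjI)
        have "(\<Sum>(x, y)\<in>D. \<bar>v y - v x\<bar>) = (\<Sum>(x, K)\<in>p'. \<bar>v (Sup K) - v (Inf K)\<bar>)"
          unfolding D_def by (subst sum.reindex[OF inj]) (simp add: ends_def case_prod_beta o_def)
        also have "\<dots> = (\<Sum>(x, K)\<in>p. if x \<in> E then \<bar>v (Sup K) - v (Inf K)\<bar> else 0)"
        proof (rule sum.mono_neutral_cong_left)
          show "\<forall>i\<in>p - p'. (case i of (x, K) \<Rightarrow> if x \<in> E then \<bar>v (Sup K) - v (Inf K)\<bar> else 0) = 0"
          proof safe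
            fix x K assume *: "(x, K) \<in> p" "(x, K) \<notin> p'"
            have "Sup K = Inf K" if "x \<in> E"
              using K[OF *(1)] * that by (auto simp: p'_def)
            then show "(if x \<in> E then \<bar>v (Sup K) - v (Inf K)\<bar> else 0) = 0" by simp
          qed
        qed (use \<open>finite p\<close> in \<open>auto simp: p'_def\<close>)
        finally have smallp: "(\<Sum>(x, K)\<in>p. if x \<in> E then \<bar>v (Sup K) - v (Inf K)\<bar> else 0) < e * (d - c)"
          using small by simp
        have ba: "d - c = (\<Sum>(x,K)\<in>p. Sup K - Inf K)" "v d - v c = (\<Sum>(x,K)\<in>p. v(Sup K) - v(Inf K))"
          using additive_tagged_division_1[where f= "\<lambda>x. x"] additive_tagged_division_1[where f= v]
            \<open>c \<le> d\<close> ptag by auto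
        have "(\<Sum>(x, k)\<in>p. measure lborel k *\<^sub>R h x) - (v d - v c) =
            (\<Sum>(x, K) \<in> p. measure lborel K *\<^sub>R h x - (v (Sup K) - v (Inf K)))"
          by (simp add: ba sum_subtractf case_prod_beta)
        also have "norm \<dots> \<le> (\<Sum>(x, K) \<in> p. e * (Sup K - Inf K) + (if x \<in> E then \<bar>v (Sup K) - v (Inf K)\<bar> else 0))"
        proof (rule sum_norm_le, safe)
          fix x K assume xK: "(x, K) \<in> p"
          then obtain a b where ab: "K = {a..b}" "Inf K = a" "Sup K = b" "a \<le> x" "x \<le> b" "c \<le> a" "b \<le> d" "{a..b} \<subseteq> ball x (r x)"
            using K by blast
          show "norm (measure lborel K *\<^sub>R h x - (v (Sup K) - v (Inf K)))
            \<le> e * (Sup K - Inf K) + (if x \<in> E then \<bar>v (Sup K) - v (Inf K)\<bar> else 0)"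
          proof (cases "x \<in> E")
            case True
            then show ?thesis using ab \<open>e > 0\<close> by (simp add: h_def abs_minus_commute)
          next
            case False
            have "a \<in> ball x (r x)" "b \<in> ball x (r x)" using ab by (meson atLeastAtMost_iff in_mono order.trans order_refl)+
            then have "norm (a - x) < r x" "norm (b - x) < r x" by (auto simp: dist_norm norm_minus_commute)
            then have 1: "norm (v a - v x - (a - x) * g x) \<le> e * norm (a - x)" 
              and 2: "norm (v b - v x - (b - x) * g x) \<le> e * norm (b - x)"
              using r(3)[of x a] r(3)[of x b] ab False by auto
            \<comment> \<open>The interval is cut at its tag \<open>x\<close>. Differentiability at
              \<open>x\<close> controls both pieces, and the errors \<open>e * (x - a)\<close> and
              \<open>e * (b - x)\<close> add up to \<open>e * (b - a)\<close>.\<close>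
            have "norm ((b - a) * g x - (v b - v a)) = norm ((v a - v x - (a - x) * g x) - (v b - v x - (b - x) * g x))"
              by (simp add: algebra_simps)
            also have "\<dots> \<le> e * (x - a) + e * (b - x)"
              using norm_triangle_ineq4[of "v a - v x - (a - x) * g x" "v b - v x - (b - x) * g x"] 1 2 ab by auto
            also have "\<dots> = e * (b - a)" by (simp add: algebra_simps)
            finally show ?thesis using False ab by (simp add: h_def)
          qed
        qed
        also have "\<dots> = e * (d - c) + (\<Sum>(x, K)\<in>p. if x \<in> E then \<bar>v (Sup K) - v (Inf K)\<bar> else 0)"
          by (simp add: ba(1) sum.distrib sum_distrib_left case_prod_beta)
        also have "\<dots> \<le> e * (d - c) + e * (d - c)" using smallp by simp
        also have "\<dots> = e0 * measure lborel (cbox c d)" using \<open>c < d\<close> by (simp add: e_def)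
        finally show ?thesis .
      qed
      moreover have "gauge (\<lambda>x. ball x (r x))" using r(1) gauge_ball_dependent by blast
      ultimately show ?thesis by (intro exI[of _ "\<lambda>x. ball x (r x)"]) simp
    qed
  qed
  then show ?thesis
    using E by (rule has_integral_spike[rotated 2]) (auto simp: h_def)
qed

section \<open>Increments weighted by \<open>xi a\<close>\<close>

lemma abs_powr_2: "\<bar>x :: real\<bar> powr 2 = x\<^sup>2"
  by (cases "x = 0") auto

lemma Lp_2_iff: "f \<in> Lp 2 M \<longleftrightarrow> f \<in> borel_measurable M \<and> integrable M (\<lambda>x. (f x)\<^sup>2)"
  by (simp add: Lp_def abs_powr_2)

lemma Lp_norm_2_sq: "(Lp_norm 2 M f)\<^sup>2 = (LINT x|M. (f x)\<^sup>2)"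
  by (simp add: Lp_norm_def abs_powr_2 powr_half_sqrt)

lemma xi_diff:
  assumes cont: "continuous_on {-1<..<1} a" and pos: "\<forall>x\<in>{-1<..<1}. a x > 0"
    and "-1 < y" "y \<le> x" "x < 1"
  shows "((\<lambda>s. 1 / a s) has_integral xi a x - xi a y) {y..x}"
proof -
  have c: "continuous_on {l..r} (\<lambda>s. 1 / a s)" if "-1 < l" "r < 1" for l r :: real
  proof -
    have "{l..r} \<subseteq> {-1<..<1}" using that by auto
    with pos show ?thesis
      by (intro continuous_intros continuous_on_subset[OF cont]) (auto simp: less_imp_neq[symmetric])
  qed
  \<comment> \<open>\<open>interval_integral_sum\<close> asks for integrability on the hull of 0,
    \<open>y\<close> and \<open>x\<close>. The hull stays inside (-1, 1), where \<open>1 / a\<close>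
    is continuous, and this covers every position of 0 relative to \<open>y\<close> and
    \<open>x\<close>.\<close>
  have "min 0 (min y x) \<le> max 0 (max y x)" by auto
  from interval_integrable_continuous_on[OF this c] assms
  have "interval_lebesgue_integrable lborel (ereal (min 0 (min y x))) (ereal (max 0 (max y x))) (\<lambda>s. 1 / a s)"
    by (simp add: min_def max_def)
  then have "interval_lebesgue_integrable lborel (min (ereal 0) (min (ereal y) (ereal x)))
      (max (ereal 0) (max (ereal y) (ereal x))) (\<lambda>s. 1 / a s)"
    by (simp add: min_def max_def split: if_splits)
  from interval_integral_sum[OF this]
  have "xi a x - xi a y = (LBINT s=y..x. 1 / a s)"
    by (simp add: xi_def zero_ereal_def)
  also have "\<dots> = integral {y..x} (\<lambda>s. 1 / a s)"
    using assms c by (intro interval_integral_eq_integral borel_integrable_atLeastAtMost') auto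
  finally show ?thesis
    using integrable_continuous_real[OF c, of y x] assms by (auto simp: has_integral_integral)
qed

text \<open>Cauchy-Schwarz in a form that only needs an AM-GM bound to be integrated for each
  \<open>k\<close>. The choice \<open>k = A / I\<close> turns the hypothesis into
  \<open>I \<le> A * G / I\<close>; for \<open>A = 0\<close>, a small \<open>k\<close> rules out
  \<open>I > 0\<close>.\<close>

lemma square_le_of_scaled_sum:
  fixes I A G :: real
  assumes "I \<ge> 0" "A \<ge> 0" "G \<ge> 0" and le: "\<And>k. k > 0 \<Longrightarrow> 2 * I \<le> k * G + A / k"
  shows "I\<^sup>2 \<le> A * G"
proof (cases "I = 0")
  case True
  then show ?thesis using assms by simp
next
  case False
  with assms have I: "I > 0" by simp
  show ?thesis
  proof (cases "A = 0")
    case True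
    have "I / (G + 1) > 0" using I \<open>G \<ge> 0\<close> by simp
    from le[OF this] have "2 * I * (G + 1) \<le> I * G" using True I \<open>G \<ge> 0\<close> by (simp add: field_simps)
    with I \<open>G \<ge> 0\<close> have "2 * (G + 1) \<le> G" by (simp add: mult.commute mult.left_commute)
    with \<open>G \<ge> 0\<close> show ?thesis by simp
  next
    case False
    with assms I have "A / I > 0" by simp
    from le[OF this] show ?thesis using I False by (simp add: field_simps power2_eq_square)
  qed
qed

text \<open>The increment is the integral of \<open>g\<close>, and \<open>\<bar>g\<bar>\<close> is
  at most half of k a g^2 + 1 / (k a) for every k > 0, by completing a square. Both terms of this
  majorant have known integrals, and optimising over k gives the product.\<close>

lemma weighted_increment_le:
  assumes cont: "continuous_on {-1<..<1} a" and pos: "\<forall>x\<in>{-1<..<1}. a x > 0"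
    and v: "loc_abs_cont v" and g: "AE x in leb_I. (v has_real_derivative g x) (at x)"
    and int: "integrable leb_I (\<lambda>x. a x * (g x)\<^sup>2)"
    and x: "x \<in> {-1<..<1}" and y: "y \<in> {-1<..<1}"
  shows "(v x - v y)\<^sup>2 \<le> \<bar>xi a x - xi a y\<bar> * (LINT x|leb_I. a x * (g x)\<^sup>2)"
proof -
  have pos': "0 < a s" "0 \<le> 1 / a s" "0 \<le> a s * (g s)\<^sup>2" if "s \<in> {-1<..<1}" for s
    using bspec[OF pos that] by auto
  have *: "(v x - v y)\<^sup>2 \<le> \<bar>xi a x - xi a y\<bar> * (LINT x|leb_I. a x * (g x)\<^sup>2)"
    if "-1 < y" "y \<le> x" "x < 1" for x y
  proof -
    have "AE x in lebesgue. x \<in> {-1<..<1} \<longrightarrow> (v has_real_derivative g x) (at x)"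
      using g by (simp add: AE_restrict_space_iff)
    then obtain E where "E \<in> null_sets lebesgue"
      "{x \<in> space lebesgue. \<not> (x \<in> {-1<..<1} \<longrightarrow> (v has_real_derivative g x) (at x))} \<subseteq> E"
      unfolding eventually_ae_filter by blast
    then have E: "negligible E" "\<And>x. x \<in> {-1<..<1} - E \<Longrightarrow> (v has_real_derivative g x) (at x)"
      by (auto simp: negligible_iff_null_sets)
    have sub: "{y..x} \<subseteq> {-1<..<1}" using that by auto
    have "abs_cont_on y x v" using v that by (auto simp: loc_abs_cont_def)
    then have I: "(g has_integral v x - v y) {y..x}"
    proof (rule abs_cont_on_integral[OF \<open>y \<le> x\<close> _ E(1)])
      fix z assume "z \<in> {y..x} - E"
      with sub have "z \<in> {-1<..<1} - E" by blast
      then show "(v has_real_derivative g z) (at z within {y..x})"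
        by (rule has_field_derivative_at_within[OF E(2)])
    qed
    have A: "((\<lambda>s. 1 / a s) has_integral xi a x - xi a y) {y..x}"
      by (rule xi_diff[OF cont pos that])
    have G0: "((\<lambda>x. a x * (g x)\<^sup>2) has_integral (LINT x|leb_I. a x * (g x)\<^sup>2)) {-1<..<1}"
      using has_integral_integral_lebesgue_on[OF int] by simp
    \<comment> \<open>For a nonnegative integrand gauge integrability is absolute integrability,
      which passes to the subinterval \<open>{y..x}\<close>.\<close>
    have abs: "(\<lambda>x. a x * (g x)\<^sup>2) absolutely_integrable_on {-1<..<1}"
      using G0 pos'(3) by (intro nonnegative_absolutely_integrable_1) (simp_all add: has_integral_integrable)
    have Gi: "(\<lambda>x. a x * (g x)\<^sup>2) integrable_on {y..x}"
      using set_integrable_subset[OF abs, of "{y..x}"] sub by (auto dest: set_lebesgue_integral_eq_integral(1))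
    have G: "integral {y..x} (\<lambda>x. a x * (g x)\<^sup>2) \<le> (LINT x|leb_I. a x * (g x)\<^sup>2)"
      using integral_subset_le[OF sub Gi] G0 pos'(3) by (simp add: integral_unique has_integral_integrable)
    have G1: "0 \<le> integral {y..x} (\<lambda>x. a x * (g x)\<^sup>2)"
      using pos'(3) sub by (intro integral_nonneg[OF Gi]) blast
    have A1: "0 \<le> xi a x - xi a y"
      using pos'(2) sub by (intro has_integral_nonneg[OF A]) blast
    have "2 * \<bar>v x - v y\<bar> \<le> k * integral {y..x} (\<lambda>x. a x * (g x)\<^sup>2) + (xi a x - xi a y) / k"
      if "k > 0" for k
    proof -
      have H: "((\<lambda>s. (k * (a s * (g s)\<^sup>2) + (1 / a s) / k) / 2) has_integral
          (k * integral {y..x} (\<lambda>x. a x * (g x)\<^sup>2) + (xi a x - xi a y) / k) / 2) {y..x}"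
        by (intro has_integral_divide has_integral_add has_integral_mult_right integrable_integral Gi A)
      have "norm (integral {y..x} g) \<le> integral {y..x} (\<lambda>s. (k * (a s * (g s)\<^sup>2) + (1 / a s) / k) / 2)"
      proof (rule integral_norm_bound_integral)
        fix s assume "s \<in> {y..x}"
        then have "a s > 0" using pos'(1) sub by blast
        with \<open>k > 0\<close> have "0 \<le> (k * a s * \<bar>g s\<bar> - 1)\<^sup>2 / (k * a s)" by simp
        also have "\<dots> = k * (a s * (g s)\<^sup>2) + (1 / a s) / k - 2 * \<bar>g s\<bar>"
          using \<open>a s > 0\<close> \<open>k > 0\<close>
          by (simp add: power2_eq_square divide_simps) (simp add: algebra_simps)
        finally show "norm (g s) \<le> (k * (a s * (g s)\<^sup>2) + (1 / a s) / k) / 2" by simp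
      qed (use I H in \<open>auto simp: has_integral_integrable\<close>)
      then show ?thesis unfolding integral_unique[OF I] integral_unique[OF H] by simp
    qed
    from square_le_of_scaled_sum[OF abs_ge_zero A1 G1 this]
    have "(v x - v y)\<^sup>2 \<le> (xi a x - xi a y) * integral {y..x} (\<lambda>x. a x * (g x)\<^sup>2)" by simp
    also have "\<dots> \<le> (xi a x - xi a y) * (LINT x|leb_I. a x * (g x)\<^sup>2)"
      by (rule mult_left_mono[OF G A1])
    finally show ?thesis using A1 by simp
  qed
  show ?thesis
  proof (cases "y \<le> x")
    case True
    then show ?thesis using * x y by auto
  next
    case False
    then show ?thesis using *[of x y] x y by (simp add: power2_commute abs_minus_commute)
  qed
qed

section \<open>Pointwise bounds in \<open>H1a a\<close>\<close>

lemma H1a_is_x_deriv: "u \<in> H1a a \<Longrightarrow> is_x_deriv u (x_deriv u)"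
  unfolding H1a_def x_deriv_def
  using someI_ex[of "is_x_deriv u"] by auto

lemma weighted_deriv_nonneg:
  fixes a g :: "real \<Rightarrow> real"
  assumes "\<forall>x\<in>{-1<..<1}. a x > 0"
  shows "0 \<le> (LINT x|leb_I. a x * (g x)\<^sup>2)"
  using assms by (intro integral_nonneg_AE AE_I2) (auto intro!: mult_nonneg_nonneg intro: less_imp_le)

lemma H1a_weighted_deriv:
  assumes pos: "\<forall>x\<in>{-1<..<1}. a x > 0" and u: "u \<in> H1a a"
  shows "integrable leb_I (\<lambda>x. a x * (x_deriv u x)\<^sup>2)"
    and "(Lp_norm 2 leb_I (\<lambda>x. sqrt (a x) * x_deriv u x))\<^sup>2 = (LINT x|leb_I. a x * (x_deriv u x)\<^sup>2)"
proof -
  have eq: "(sqrt (a x) * x_deriv u x)\<^sup>2 = a x * (x_deriv u x)\<^sup>2" if "x \<in> space leb_I" for x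
    using bspec[OF pos, of x] that by (simp add: power_mult_distrib)
  have "integrable leb_I (\<lambda>x. (sqrt (a x) * x_deriv u x)\<^sup>2)"
    using u by (simp add: H1a_def Lp_2_iff)
  then show "integrable leb_I (\<lambda>x. a x * (x_deriv u x)\<^sup>2)"
    by (subst (asm) Bochner_Integration.integrable_cong[OF refl eq]) auto
  show "(Lp_norm 2 leb_I (\<lambda>x. sqrt (a x) * x_deriv u x))\<^sup>2 = (LINT x|leb_I. a x * (x_deriv u x)\<^sup>2)"
    unfolding Lp_norm_2_sq by (rule Bochner_Integration.integral_cong[OF refl eq])
qed

text \<open>The increment bound compares the representative \<open>v\<close> at every pair of
  points, so \<open>x\<close> can be fixed while \<open>y\<close> is averaged. The exchange of
  \<open>v\<close> for \<open>u\<close> happens inside the average for \<open>y\<close>, and at the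
  very end for \<open>x\<close>, where it costs a null set.\<close>

lemma H1a_pointwise:
  assumes cont: "continuous_on {-1<..<1} a" and pos: "\<forall>x\<in>{-1<..<1}. a x > 0"
    and u: "u \<in> H1a a" and K: "\<forall>y\<in>{-1/2..1/2}. \<bar>xi a y\<bar> \<le> K"
  shows "AE x in leb_I. (u x)\<^sup>2 \<le> 2 * (LINT y|leb_I. (u y)\<^sup>2)
      + 2 * (\<bar>xi a x\<bar> + K) * (LINT y|leb_I. a y * (x_deriv u y)\<^sup>2)"
proof -
  define D where "D = (LINT y|leb_I. a y * (x_deriv u y)\<^sup>2)"
  have int: "integrable leb_I (\<lambda>x. a x * (x_deriv u x)\<^sup>2)"
    by (rule H1a_weighted_deriv(1)[OF pos u])
  have D0: "D \<ge> 0" unfolding D_def by (rule weighted_deriv_nonneg[OF pos])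
  have u2: "integrable leb_I (\<lambda>x. (u x)\<^sup>2)" using u by (simp add: H1a_def Lp_2_iff)
  from H1a_is_x_deriv[OF u] obtain v where v: "AE x in leb_I. v x = u x" "loc_abs_cont v"
    "AE x in leb_I. (v has_real_derivative x_deriv u x) (at x)"
    by (auto simp: is_x_deriv_def)
  have vx: "(v x)\<^sup>2 \<le> 2 * (LINT y|leb_I. (u y)\<^sup>2) + 2 * (\<bar>xi a x\<bar> + K) * D" if x: "x \<in> {-1<..<1}" for x
  proof -
    \<comment> \<open>Collects what does not depend on \<open>y\<close>, so that its integral over
      an interval of measure 1 is \<open>c\<close> itself.\<close>
    define c where "c = (v x)\<^sup>2 - 2 * (\<bar>xi a x\<bar> + K) * D"
    have c: "c \<le> 2 * (v y)\<^sup>2" if y: "y \<in> {-1/2..1/2}" for y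
    proof -
      have "(v x)\<^sup>2 \<le> 2 * (v y)\<^sup>2 + 2 * (v x - v y)\<^sup>2"
        using zero_le_power2[of "2 * v y - v x"] by (simp add: power2_eq_square algebra_simps)
      also have "(v x - v y)\<^sup>2 \<le> \<bar>xi a x - xi a y\<bar> * D"
        unfolding D_def using y x by (intro weighted_increment_le[OF cont pos v(2,3) int]) auto
      also have "\<dots> \<le> (\<bar>xi a x\<bar> + K) * D"
        using bspec[OF K y] D0 by (intro mult_right_mono) auto
      finally show ?thesis by (simp add: c_def algebra_simps)
    qed
    have S: "{-1/2..1/2} \<in> sets leb_I" by (auto simp: sets_restrict_space_iff)
    have sub: "{-1/2..1/2} \<subseteq> {-1<..<1::real}" by auto
    have m: "measure leb_I {-1/2..1/2} = 1" "emeasure leb_I {-1/2..1/2} = 1"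
      using measure_restrict_space[OF _ sub, of lebesgue] emeasure_restrict_space[OF _ sub, of lebesgue]
      by simp_all
    have "(LINT y|leb_I. indicator {-1/2..1/2} y *\<^sub>R c) \<le> (LINT y|leb_I. 2 * (u y)\<^sup>2)"
    proof (rule integral_mono_AE)
      show "integrable leb_I (\<lambda>y. indicator {-1/2..1/2} y *\<^sub>R c)"
        using S m by (intro integrable_indicator) auto
      show "AE y in leb_I. indicator {-1/2..1/2} y *\<^sub>R c \<le> 2 * (u y)\<^sup>2"
        using v(1)
      proof eventually_elim
        case (elim y)
        then show ?case using c[of y] by (cases "y \<in> {-1/2..1/2}") simp_all
      qed
    qed (use u2 in auto)
    also have "(LINT y|leb_I. indicator {-1/2..1/2} y *\<^sub>R c) = c"
      using S m Int_absorb2[OF sub] by simp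
    finally show ?thesis by (simp add: c_def)
  qed
  have "AE x in leb_I. x \<in> {-1<..<1}" by (rule AE_I2) simp
  with v(1) show ?thesis
    unfolding D_def[symmetric]
  proof eventually_elim
    case (elim x)
    then show ?case using vx[of x] by simp
  qed
qed

section \<open>Interpolation on one time slice\<close>

text \<open>The cases meet at \<open>s = w powr (1 / (4 - p))\<close>, where
  \<open>s powr (p - 2) * w\<close> equals \<open>s\<^sup>2\<close>. Above this threshold the square
  dominates. Below it the product is at most \<open>w powr (2 / (4 - p))\<close>, and
  \<open>w \<ge> 1\<close> with \<open>2 \<le> p\<close> allows the exponent to be raised to
  \<open>p / (4 - p)\<close>.\<close>

lemma powr_mult_le_sum:
  fixes s w p :: real
  assumes "s \<ge> 0" "w \<ge> 1" "2 \<le> p" "p < 4"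
  shows "s powr (p - 2) * w \<le> s\<^sup>2 + w powr (p / (4 - p))"
proof (cases "s \<le> w powr (1 / (4 - p))")
  case True
  have "s powr (p - 2) * w \<le> (w powr (1 / (4 - p))) powr (p - 2) * w powr 1"
    using True assms by (intro mult_mono powr_mono2) auto
  also have "\<dots> = w powr (1 / (4 - p) * (p - 2) + 1)"
    by (simp only: powr_powr powr_add)
  also have "1 / (4 - p) * (p - 2) + 1 = 2 / (4 - p)" using assms by (simp add: field_simps)
  also have "w powr (2 / (4 - p)) \<le> w powr (p / (4 - p))"
    using assms by (intro powr_mono divide_right_mono) auto
  finally show ?thesis by (simp add: add_increasing)
next
  case False
  have "w = (w powr (1 / (4 - p))) powr (4 - p)" using assms by (simp add: powr_powr)
  also have "\<dots> \<le> s powr (4 - p)" using False assms by (intro powr_mono2) auto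
  finally have "s powr (p - 2) * w \<le> s powr (p - 2) * s powr (4 - p)"
    by (intro mult_left_mono) auto
  also have "\<dots> = s powr 2" by (simp flip: powr_add)
  also have "\<dots> = s\<^sup>2" using assms abs_powr_2[of s] by simp
  finally show ?thesis by (simp add: add_increasing2)
qed

text \<open>The Young step is applied to \<open>\<bar>u\<bar> / M\<close>. Once \<open>M\<close>
  bounds the L2 norm, the term \<open>u\<^sup>2 / M\<^sup>2\<close> integrates to at most 1, and the
  right side has total degree \<open>p\<close> in \<open>M\<close> when \<open>D\<close> is of order
  M^2.\<close>

lemma powr_interpolate:
  fixes u w p M D :: real
  assumes u: "u\<^sup>2 \<le> 2 * w * (M\<^sup>2 + D)" and "w \<ge> 1" "M > 0" "D \<ge> 0" "2 \<le> p" "p < 4"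
  shows "\<bar>u\<bar> powr p \<le> 2 * M powr (p - 2) * (M\<^sup>2 + D) * (u\<^sup>2 / M\<^sup>2 + w powr (p / (4 - p)))"
proof -
  have "\<bar>u\<bar> powr p = \<bar>u\<bar> powr (p - 2) * \<bar>u\<bar> powr 2"
    by (simp only: powr_add[symmetric]) simp
  also have "\<dots> = \<bar>u\<bar> powr (p - 2) * u\<^sup>2" by (simp add: abs_powr_2)
  also have "\<dots> \<le> \<bar>u\<bar> powr (p - 2) * (2 * w * (M\<^sup>2 + D))" using u by (intro mult_left_mono) auto
  also have "\<bar>u\<bar> powr (p - 2) = M powr (p - 2) * (\<bar>u\<bar> / M) powr (p - 2)"
    using \<open>M > 0\<close> by (simp flip: powr_mult)
  also have "\<dots> * (2 * w * (M\<^sup>2 + D)) = 2 * M powr (p - 2) * (M\<^sup>2 + D) * ((\<bar>u\<bar> / M) powr (p - 2) * w)"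
    by simp
  also have "\<dots> \<le> 2 * M powr (p - 2) * (M\<^sup>2 + D) * ((\<bar>u\<bar> / M)\<^sup>2 + w powr (p / (4 - p)))"
    using assms by (intro mult_left_mono powr_mult_le_sum) auto
  finally show ?thesis by (simp add: power_divide)
qed

text \<open>Stated with the nonnegative integral because the integrability of
  \<open>\<bar>u x\<bar> powr p\<close> is itself at stake.\<close>

lemma H1a_powr_integral:
  assumes cont: "continuous_on {-1<..<1} a" and pos: "\<forall>x\<in>{-1<..<1}. a x > 0"
    and u: "u \<in> H1a a" and K: "\<forall>y\<in>{-1/2..1/2}. \<bar>xi a y\<bar> \<le> K"
    and p: "2 \<le> p" "p < 4"
    and W: "integrable leb_I (\<lambda>x. (\<bar>xi a x\<bar> + K + 1) powr (p / (4 - p)))"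
    and M: "M > 0" "(LINT y|leb_I. (u y)\<^sup>2) \<le> M\<^sup>2"
  shows "(\<integral>\<^sup>+x. ennreal (\<bar>u x\<bar> powr p) \<partial>leb_I) \<le>
     ennreal (2 * M powr (p - 2) * (1 + (LINT x|leb_I. (\<bar>xi a x\<bar> + K + 1) powr (p / (4 - p))))
       * (M\<^sup>2 + (LINT y|leb_I. a y * (x_deriv u y)\<^sup>2)))"
proof -
  define D where "D = (LINT y|leb_I. a y * (x_deriv u y)\<^sup>2)"
  define W where "W x = (\<bar>xi a x\<bar> + K + 1) powr (p / (4 - p))" for x
  have D0: "D \<ge> 0" unfolding D_def by (rule weighted_deriv_nonneg[OF pos])
  have K0: "K \<ge> 0" using K by force
  have u2: "integrable leb_I (\<lambda>x. (u x)\<^sup>2)" using u by (simp add: H1a_def Lp_2_iff)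
  define F where "F x = 2 * M powr (p - 2) * (M\<^sup>2 + D) * ((u x)\<^sup>2 / M\<^sup>2 + W x)" for x
  have Wi: "integrable leb_I W" unfolding W_def by (rule W)
  have Fi: "integrable leb_I F"
    unfolding F_def using u2 Wi by (intro integrable_mult_right Bochner_Integration.integrable_add integrable_divide) auto
  have F0: "F x \<ge> 0" for x unfolding F_def W_def using M D0 by (intro mult_nonneg_nonneg add_nonneg_nonneg) auto
  have "AE x in leb_I. (u x)\<^sup>2 \<le> 2 * (LINT y|leb_I. (u y)\<^sup>2) + 2 * (\<bar>xi a x\<bar> + K) * D"
    unfolding D_def by (rule H1a_pointwise[OF cont pos u K])
  then have "AE x in leb_I. ennreal (\<bar>u x\<bar> powr p) \<le> ennreal (F x)"
  proof eventually_elim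
    case (elim x)
    let ?w = "\<bar>xi a x\<bar> + K + 1"
    have "(u x)\<^sup>2 \<le> 2 * M\<^sup>2 + 2 * (\<bar>xi a x\<bar> + K) * D" using elim M by simp
    also have "\<dots> \<le> 2 * ?w * M\<^sup>2 + 2 * ?w * D"
      using K0 D0 by (intro add_mono mult_right_mono) auto
    finally have "(u x)\<^sup>2 \<le> 2 * ?w * (M\<^sup>2 + D)" by (simp add: algebra_simps)
    from powr_interpolate[OF this _ M(1) D0 p] show ?case
      unfolding F_def W_def using K0 by (intro ennreal_leI) auto
  qed
  then have "(\<integral>\<^sup>+x. ennreal (\<bar>u x\<bar> powr p) \<partial>leb_I) \<le> (\<integral>\<^sup>+x. ennreal (F x) \<partial>leb_I)"
    by (rule nn_integral_mono_AE)
  also have "\<dots> = ennreal (LINT x|leb_I. F x)"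
    by (rule nn_integral_eq_integral[OF Fi]) (simp add: F0)
  also have "(LINT x|leb_I. F x) = 2 * M powr (p - 2) * (M\<^sup>2 + D) * ((LINT y|leb_I. (u y)\<^sup>2) / M\<^sup>2 + (LINT x|leb_I. W x))"
    unfolding F_def using u2 Wi by simp
  also have "\<dots> \<le> 2 * M powr (p - 2) * (M\<^sup>2 + D) * (1 + (LINT x|leb_I. W x))"
    using M D0 by (intro mult_left_mono add_mono mult_nonneg_nonneg) (auto simp: divide_le_eq)
  finally show ?thesis
    unfolding D_def W_def by (simp add: ennreal_leI mult_ac)
qed

section \<open>Measurability and Tonelli for Lebesgue measure\<close>

text \<open>Rests on the completeness of Lebesgue measure. It serves the weighted derivative
  integral as a function of time, which is only known to agree almost everywhere with a measurable
  function.\<close>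

lemma measurable_lebesgue_on_AE:
  fixes f g :: "'a::euclidean_space \<Rightarrow> 'b::euclidean_space"
  assumes f: "f \<in> borel_measurable (lebesgue_on S)" and S: "S \<in> sets lebesgue"
    and ae: "AE x in lebesgue_on S. f x = g x"
  shows "g \<in> borel_measurable (lebesgue_on S)"
proof -
  have "(\<lambda>x. if x \<in> S then f x else 0) \<in> borel_measurable lebesgue"
    using f S by (simp add: borel_measurable_if)
  moreover have "AE x in lebesgue. (if x \<in> S then f x else 0) = (if x \<in> S then g x else 0)"
    using ae S by (auto simp: AE_restrict_space_iff elim!: eventually_mono)
  ultimately have "(\<lambda>x. if x \<in> S then g x else 0) \<in> borel_measurable lebesgue"
    by (rule borel_measurable_AE)
  then show ?thesis using S by (simp add: borel_measurable_if)
qed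

lemma integrable_const_lebesgue_on_Ioo:
  "integrable (lebesgue_on {l<..<r :: real}) (\<lambda>_. c :: real)"
  by (intro finite_measure.integrable_const finite_measure_lebesgue_on) auto

text \<open>Tonelli for the completed product measure. Single slices of \<open>f\<close> may fail to
  be measurable, so \<open>f\<close> is exchanged for a Borel function \<open>g\<close>, almost all
  of whose slices agree almost everywhere with those of \<open>f\<close>. The nonnegative integral
  has the same value under a measure and its completion.\<close>

lemma nn_integral_lebesgue_on_Times:
  fixes f :: "'a::euclidean_space \<times> 'b::euclidean_space \<Rightarrow> ennreal"
  assumes f: "f \<in> borel_measurable (lebesgue_on (A \<times> A'))"
    and A: "A \<in> sets borel" and A': "A' \<in> sets borel"
  shows "(\<integral>\<^sup>+z. f z \<partial>lebesgue_on (A \<times> A')) = (\<integral>\<^sup>+t. (\<integral>\<^sup>+x. f (t, x) \<partial>lebesgue_on A') \<partial>lebesgue_on A)"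
proof -
  define F where "F z = f z * indicator (A \<times> A') z" for z
  have "A \<times> A' \<in> sets (lborel \<Otimes>\<^sub>M lborel)" using A A' by (intro pair_measureI) auto
  then have AA: "A \<times> A' \<in> sets lborel" by (simp only: lborel_prod)
  have F: "F \<in> borel_measurable lebesgue"
    using f AA unfolding F_def by (subst (asm) borel_measurable_restrict_space_iff_ennreal) auto
  then obtain g where g: "g \<in> borel_measurable lborel" "AE z in lborel. F z = g z"
    using completion_ex_borel_measurable by blast
  have g': "g \<in> borel_measurable (lborel \<Otimes>\<^sub>M lborel)" using g(1) by (simp only: lborel_prod)
  have "AE z in lborel \<Otimes>\<^sub>M lborel. F z = g z" using g(2) by (simp only: lborel_prod)
  then have ae: "AE t in lborel. AE x in lborel. F (t, x) = g (t, x)" by (rule lborel_pair.AE_pair)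
  have "(\<integral>\<^sup>+z. f z \<partial>lebesgue_on (A \<times> A')) = (\<integral>\<^sup>+z. F z \<partial>lebesgue)"
    unfolding F_def using AA by (intro nn_integral_restrict_space) auto
  also have "\<dots> = (\<integral>\<^sup>+z. g z \<partial>lborel)"
    using g(2) by (simp add: nn_integral_completion cong: nn_integral_cong_AE)
  also have "\<dots> = (\<integral>\<^sup>+z. g z \<partial>(lborel \<Otimes>\<^sub>M lborel))" by (simp only: lborel_prod)
  also have "\<dots> = (\<integral>\<^sup>+t. (\<integral>\<^sup>+x. g (t, x) \<partial>lborel) \<partial>lborel)"
    by (rule lborel.nn_integral_fst[OF g', symmetric])
  also have "\<dots> = (\<integral>\<^sup>+t. (\<integral>\<^sup>+x. F (t, x) \<partial>lborel) \<partial>lborel)"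
    using ae by (intro nn_integral_cong_AE) (auto elim!: eventually_mono intro!: nn_integral_cong_AE)
  also have "\<dots> = (\<integral>\<^sup>+t. (\<integral>\<^sup>+x. F (t, x) \<partial>lebesgue) \<partial>lebesgue)"
    by (simp only: nn_integral_completion)
  also have "\<dots> = (\<integral>\<^sup>+t. (\<integral>\<^sup>+x. f (t, x) * indicator A' x \<partial>lebesgue) * indicator A t \<partial>lebesgue)"
    by (intro nn_integral_cong) (auto simp: F_def indicator_def intro!: nn_integral_cong)
  also have "\<dots> = (\<integral>\<^sup>+t. (\<integral>\<^sup>+x. f (t, x) \<partial>lebesgue_on A') \<partial>lebesgue_on A)"
    using A A' by (simp add: nn_integral_restrict_space)
  finally show ?thesis .
qed

section \<open>Dependence of the slice norms on time\<close>

text \<open>The pointwise bound \<open>ineq\<close> splits the change of the squared norm into a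
  multiple of the squared L2 distance, which tends to 0, and a remainder as small as
  \<open>k\<close> allows. Continuity later yields measurability in time and a finite
  supremum.\<close>

lemma C_L2_continuous_sq_norm:
  assumes "u \<in> C_L2 T"
  shows "continuous_on {0..T} (\<lambda>t. LINT x|leb_I. (u (t, x))\<^sup>2)"
  unfolding continuous_on_def
proof (intro ballI tendstoI)
  fix t e :: real assume t: "t \<in> {0..T}" and "e > 0"
  define N where "N s = (LINT x|leb_I. (u (s, x))\<^sup>2)" for s
  have L: "(\<lambda>x. u (s, x)) \<in> borel_measurable leb_I" "integrable leb_I (\<lambda>x. (u (s, x))\<^sup>2)" if "s \<in> {0..T}" for s
    using assms that by (auto simp: C_L2_def Lp_2_iff)
  define \<delta> where "\<delta> s = Lp_norm 2 leb_I (\<lambda>x. u (s, x) - u (t, x))" for s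
  have \<delta>: "(\<delta> \<longlongrightarrow> 0) (at t within {0..T})"
    using assms t unfolding \<delta>_def C_L2_def by blast
  have "N t \<ge> 0" by (simp add: N_def)
  \<comment> \<open>Makes \<open>k * N t\<close> less than \<open>e / 2\<close>; the added 1 keeps
    the denominator positive when \<open>N t = 0\<close>.\<close>
  define k where "k = e / (2 * (N t + 1))"
  have "k > 0" "k * N t < e / 2" using \<open>e > 0\<close> \<open>N t \<ge> 0\<close>
    by (simp_all add: k_def field_simps)
  have "((\<lambda>s. (1 + 1 / k) * (\<delta> s)\<^sup>2) \<longlongrightarrow> (1 + 1 / k) * 0\<^sup>2) (at t within {0..T})"
    by (intro tendsto_intros \<delta>)
  then have "\<forall>\<^sub>F s in at t within {0..T}. (1 + 1 / k) * (\<delta> s)\<^sup>2 < e / 2"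
    using \<open>e > 0\<close> by (intro order_tendstoD(2)) auto
  moreover have "\<forall>\<^sub>F s in at t within {0..T}. s \<in> {0..T}"
    by (simp add: eventually_at_filter)
  ultimately show "\<forall>\<^sub>F s in at t within {0..T}. dist (LINT x|leb_I. (u (s, x))\<^sup>2) (LINT x|leb_I. (u (t, x))\<^sup>2) < e"
  proof eventually_elim
    case (elim s)
    have d: "integrable leb_I (\<lambda>x. (u (s, x) - u (t, x))\<^sup>2)"
    proof (rule Bochner_Integration.integrable_bound)
      show "integrable leb_I (\<lambda>x. 2 * (u (s, x))\<^sup>2 + 2 * (u (t, x))\<^sup>2)"
        using L[OF t] L[OF elim(2)] by simp
      show "(\<lambda>x. (u (s, x) - u (t, x))\<^sup>2) \<in> borel_measurable leb_I"
        using L(1)[OF t] L(1)[OF elim(2)] by measurable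
      have "(a - b)\<^sup>2 \<le> 2 * a\<^sup>2 + 2 * b\<^sup>2" for a b :: real
        using zero_le_power2[of "a + b"] by (simp add: power2_eq_square algebra_simps)
      then show "AE x in leb_I. norm ((u (s, x) - u (t, x))\<^sup>2) \<le> norm (2 * (u (s, x))\<^sup>2 + 2 * (u (t, x))\<^sup>2)"
        by simp
    qed
    have ineq: "\<bar>a\<^sup>2 - b\<^sup>2\<bar> \<le> (1 + 1 / k) * (a - b)\<^sup>2 + k * b\<^sup>2" for a b :: real
    proof -
      \<comment> \<open>Weighted AM-GM for the cross term \<open>2 * (a - b) * b\<close>.\<close>
      have "0 \<le> (\<bar>a - b\<bar> - k * \<bar>b\<bar>)\<^sup>2 / k" using \<open>k > 0\<close> by simp
      also have "\<dots> = (a - b)\<^sup>2 / k + k * b\<^sup>2 - 2 * \<bar>a - b\<bar> * \<bar>b\<bar>"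
        using \<open>k > 0\<close> by (simp add: power2_diff power_mult_distrib diff_divide_distrib add_divide_distrib) (simp add: power2_eq_square)
      finally have *: "2 * \<bar>a - b\<bar> * \<bar>b\<bar> \<le> (a - b)\<^sup>2 / k + k * b\<^sup>2" by simp
      have "a\<^sup>2 - b\<^sup>2 = (a - b)\<^sup>2 + 2 * ((a - b) * b)" by (simp add: power2_eq_square algebra_simps)
      also have "\<bar>\<dots>\<bar> \<le> (a - b)\<^sup>2 + 2 * \<bar>a - b\<bar> * \<bar>b\<bar>"
        using abs_triangle_ineq[of "(a - b)\<^sup>2" "2 * ((a - b) * b)"] by (simp add: abs_mult)
      finally show ?thesis using * by (simp add: algebra_simps)
    qed
    have "\<bar>N s - N t\<bar> = \<bar>LINT x|leb_I. (u (s, x))\<^sup>2 - (u (t, x))\<^sup>2\<bar>"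
      unfolding N_def using L[OF t] L[OF elim(2)] by simp
    also have "\<dots> \<le> (LINT x|leb_I. \<bar>(u (s, x))\<^sup>2 - (u (t, x))\<^sup>2\<bar>)"
      by (rule integral_abs_bound)
    also have "\<dots> \<le> (LINT x|leb_I. (1 + 1 / k) * (u (s, x) - u (t, x))\<^sup>2 + k * (u (t, x))\<^sup>2)"
      using L[OF t] L[OF elim(2)] d ineq by (intro integral_mono) auto
    also have "\<dots> = (1 + 1 / k) * (\<delta> s)\<^sup>2 + k * N t"
      using L[OF t] d unfolding \<delta>_def N_def Lp_norm_2_sq by simp
    also have "\<dots> < e" using elim(1) \<open>k * N t < e / 2\<close> by linarith
    finally show ?case by (simp add: N_def dist_real_def)
  qed
qed

text \<open>\<open>x_deriv\<close> is chosen separately on each slice, so measurability in time of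
  the derivative term is obtained indirectly: almost everywhere it is the squared \<open>H1a\<close>
  norm, integrable by the definition of \<open>L2_H1a\<close>, minus the squared L2 norm, which is
  continuous.\<close>

lemma B_slices:
  assumes pos: "\<forall>x\<in>{-1<..<1}. a x > 0" and T: "T > 0" and u: "u \<in> B a T"
  shows "AE t in lebesgue_on {0<..<T}. (\<lambda>x. u (t, x)) \<in> H1a a"
    and "integrable (lebesgue_on {0<..<T}) (\<lambda>t. LINT x|leb_I. a x * (x_deriv (\<lambda>y. u (t, y)) x)\<^sup>2)"
    and "t \<in> {0..T} \<Longrightarrow> (LINT x|leb_I. (u (t, x))\<^sup>2) \<le> (B_norm a T u)\<^sup>2"
    and "(LINT t|lebesgue_on {0<..<T}. LINT x|leb_I. a x * (x_deriv (\<lambda>y. u (t, y)) x)\<^sup>2) \<le> (B_norm a T u)\<^sup>2"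
    and "B_norm a T u \<ge> 0"
proof -
  let ?I = "lebesgue_on {0<..<T}"
  define N where "N t = (LINT x|leb_I. (u (t, x))\<^sup>2)" for t
  define D where "D t = (LINT x|leb_I. a x * (x_deriv (\<lambda>y. u (t, y)) x)\<^sup>2)" for t
  have C: "u \<in> C_L2 T" and L: "u \<in> L2_H1a a T" using u by (auto simp: B_def)
  show H: "AE t in ?I. (\<lambda>x. u (t, x)) \<in> H1a a" using L by (simp add: L2_H1a_def)
  have Hi: "integrable ?I (\<lambda>t. (H1a_norm a (\<lambda>x. u (t, x)))\<^sup>2)"
    using L by (simp add: L2_H1a_def)
  have N0: "N t \<ge> 0" for t by (simp add: N_def)
  \<comment> \<open>Valid for every \<open>t\<close>: where the integrand is not integrable, the
    integral has the default value 0.\<close>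
  have D0: "D t \<ge> 0" for t unfolding D_def by (rule weighted_deriv_nonneg[OF pos])
  have HND: "AE t in ?I. (H1a_norm a (\<lambda>x. u (t, x)))\<^sup>2 = N t + D t"
    using H
  proof eventually_elim
    case (elim t)
    show ?case
      using H1a_weighted_deriv(2)[OF pos elim] add_nonneg_nonneg[OF N0[of t] D0[of t]]
      by (simp add: H1a_norm_def Lp_norm_2_sq N_def D_def)
  qed
  have Nc: "continuous_on {0..T} N"
    unfolding N_def by (rule C_L2_continuous_sq_norm[OF C])
  then have "continuous_on {0<..<T} N" by (rule continuous_on_subset) auto
  then have Nm: "N \<in> borel_measurable ?I"
    by (intro continuous_imp_measurable_on_sets_lebesgue) auto
  have HNm: "(\<lambda>t. (H1a_norm a (\<lambda>x. u (t, x)))\<^sup>2 - N t) \<in> borel_measurable ?I"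
    using Nm Hi by auto
  have "D \<in> borel_measurable ?I"
  proof (rule measurable_lebesgue_on_AE[OF HNm])
    show "AE t in ?I. (H1a_norm a (\<lambda>x. u (t, x)))\<^sup>2 - N t = D t"
      using HND by eventually_elim simp
  qed simp
  show Di: "integrable ?I (\<lambda>t. LINT x|leb_I. a x * (x_deriv (\<lambda>y. u (t, y)) x)\<^sup>2)"
    unfolding D_def[symmetric]
  proof (rule Bochner_Integration.integrable_bound[OF Hi])
    show "D \<in> borel_measurable ?I" by fact
    show "AE t in ?I. norm (D t) \<le> norm ((H1a_norm a (\<lambda>x. u (t, x)))\<^sup>2)"
      using HND by eventually_elim (use N0 D0 in auto)
  qed
  \<comment> \<open>Without an upper bound the real supremum in \<open>B_norm\<close> would not
    dominate the slice norms.\<close>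
  have bdd: "bdd_above (N ` {0..T})"
    using compact_continuous_image[OF Nc] by (simp add: compact_imp_bounded bounded_imp_bdd_above)
  have SN: "N t \<le> (SUP t\<in>{0..T}. N t)" if "t \<in> {0..T}" for t
    using that bdd by (rule cSUP_upper)
  have S0: "0 \<le> (SUP t\<in>{0..T}. N t)" using SN[of 0] N0[of 0] T by auto
  have I0: "0 \<le> (LINT t|?I. D t)" using D0 by (intro integral_nonneg_AE AE_I2) auto
  have B: "B_norm a T u = sqrt ((SUP t\<in>{0..T}. N t) + 2 * (LINT t|?I. D t))"
    by (simp add: B_norm_def Lp_norm_2_sq N_def D_def)
  show "B_norm a T u \<ge> 0" using S0 I0 by (simp add: B)
  have B2: "(B_norm a T u)\<^sup>2 = (SUP t\<in>{0..T}. N t) + 2 * (LINT t|?I. D t)"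
    using S0 I0 by (simp add: B)
  show "(LINT x|leb_I. (u (t, x))\<^sup>2) \<le> (B_norm a T u)\<^sup>2" if "t \<in> {0..T}"
    using SN[OF that] I0 by (simp add: B2 N_def[symmetric])
  show "(LINT t|?I. LINT x|leb_I. a x * (x_deriv (\<lambda>y. u (t, y)) x)\<^sup>2) \<le> (B_norm a T u)\<^sup>2"
    using S0 I0 by (simp add: B2 D_def[symmetric])
qed

section \<open>Integration in time and the embedding\<close>

text \<open>Integrating M^2 + D(t) over (0, T) gives T M^2 plus at most M^2, hence the factor
  \<open>T + 1\<close>; the remaining \<open>M powr (p - 2)\<close> completes the power
  \<open>M powr p\<close>.\<close>

lemma B_powr_integral:
  assumes cont: "continuous_on {-1<..<1} a" and pos: "\<forall>x\<in>{-1<..<1}. a x > 0"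
    and T: "T > 0" and u: "u \<in> B a T"
    and K: "\<forall>y\<in>{-1/2..1/2}. \<bar>xi a y\<bar> \<le> K"
    and p: "2 \<le> p" "p < 4"
    and W: "integrable leb_I (\<lambda>x. (\<bar>xi a x\<bar> + K + 1) powr (p / (4 - p)))"
    and M: "M > 0" "B_norm a T u \<le> M"
  shows "(\<integral>\<^sup>+z. ennreal (\<bar>u z\<bar> powr p) \<partial>lebesgue_on (Q T)) \<le>
     ennreal (2 * (1 + (LINT x|leb_I. (\<bar>xi a x\<bar> + K + 1) powr (p / (4 - p)))) * (T + 1) * M powr p)"
proof -
  let ?I = "lebesgue_on {0<..<T}"
  define C where "C = 1 + (LINT x|leb_I. (\<bar>xi a x\<bar> + K + 1) powr (p / (4 - p)))"
  have C0: "C \<ge> 0" unfolding C_def by (intro add_nonneg_nonneg integral_nonneg_AE AE_I2) auto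
  define D where "D t = (LINT x|leb_I. a x * (x_deriv (\<lambda>y. u (t, y)) x)\<^sup>2)" for t
  note S = B_slices[OF pos T u, folded D_def]
  have D0: "D t \<ge> 0" for t unfolding D_def by (rule weighted_deriv_nonneg[OF pos])
  have BM: "(B_norm a T u)\<^sup>2 \<le> M\<^sup>2" using S(5) M(2) by (intro power_mono)
  have um: "u \<in> borel_measurable (lebesgue_on (Q T))" using u by (simp add: B_def)
  have "AE t in ?I. t \<in> {0<..<T}" by (rule AE_I2) simp
  with S(1) have ae: "AE t in ?I. (\<integral>\<^sup>+x. ennreal (\<bar>u (t, x)\<bar> powr p) \<partial>leb_I)
      \<le> ennreal (2 * M powr (p - 2) * C * (M\<^sup>2 + D t))"
  proof eventually_elim
    case (elim t)
    have "(LINT x|leb_I. (u (t, x))\<^sup>2) \<le> M\<^sup>2" using S(3)[of t] elim BM by auto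
    from H1a_powr_integral[OF cont pos elim(1) K p W M(1) this]
    show ?case unfolding C_def D_def .
  qed
  have "(\<integral>\<^sup>+z. ennreal (\<bar>u z\<bar> powr p) \<partial>lebesgue_on (Q T)) =
      (\<integral>\<^sup>+t. (\<integral>\<^sup>+x. ennreal (\<bar>u (t, x)\<bar> powr p) \<partial>leb_I) \<partial>?I)"
    using um unfolding Q_def by (intro nn_integral_lebesgue_on_Times) auto
  also have "\<dots> \<le> (\<integral>\<^sup>+t. ennreal (2 * M powr (p - 2) * C * (M\<^sup>2 + D t)) \<partial>?I)"
    by (rule nn_integral_mono_AE[OF ae])
  also have "\<dots> = ennreal (LINT t|?I. 2 * M powr (p - 2) * C * (M\<^sup>2 + D t))"
    using S(2) C0 D0 T by (intro nn_integral_eq_integral integrable_mult_right Bochner_Integration.integrable_add)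
      (auto intro!: AE_I2 integrable_const_lebesgue_on_Ioo)
  also have "(LINT t|?I. 2 * M powr (p - 2) * C * (M\<^sup>2 + D t)) = 2 * M powr (p - 2) * C * (M\<^sup>2 * T + (LINT t|?I. D t))"
    using S(2) T by (simp add: measure_restrict_space integrable_const_lebesgue_on_Ioo mult.commute)
  also have "\<dots> \<le> 2 * M powr (p - 2) * C * (M\<^sup>2 * T + M\<^sup>2)"
    using S(4) BM C0 by (intro mult_left_mono) auto
  also have "\<dots> = 2 * C * (T + 1) * (M powr (p - 2) * M powr 2)"
    using abs_powr_2[of M] M by (simp add: algebra_simps)
  also have "M powr (p - 2) * M powr 2 = M powr p" by (simp only: powr_add[symmetric]) simp
  finally show ?thesis unfolding C_def by (simp add: ennreal_leI)
qed

theorem corollary3p4: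
  fixes a :: "real \<Rightarrow> real" and T \<theta> :: real
  assumes "C1_on {-1..1} a"
    and "\<And>x. x \<in> {-1<..<1} \<Longrightarrow> a x > 0"
    and "a (-1) = 0" and "a 1 = 0"
    and "T > 0"
    and "1 \<le> \<theta>" and "\<theta> < 3"
    and "xi a \<in> Lp ((1 + \<theta>) / (3 - \<theta>)) leb_I"
  shows "B a T \<subseteq> Lp (1 + \<theta>) (lebesgue_on (Q T)) \<and>
    (\<exists>c>0. \<forall>u\<in>B a T.
       Lp_norm (1 + \<theta>) (lebesgue_on (Q T)) u
         \<le> c * T powr ((3 - \<theta>) / (4 * (1 + \<theta>))) * B_norm a T u)"
proof -
  define p where "p = 1 + \<theta>"
  have p: "2 \<le> p" "p < 4" using assms(6,7) by (simp_all add: p_def)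
  have "continuous_on {-1..1} a"
    using assms(1) unfolding C1_on_def
    by (meson DERIV_continuous continuous_on_eq_continuous_within)
  then have cont: "continuous_on {-1<..<1} a" by (rule continuous_on_subset) auto
  have pos: "\<forall>x\<in>{-1<..<1}. a x > 0" using assms(2) by blast
  \<comment> \<open>\<open>xi a\<close> is increasing, as a primitive of the positive function
    \<open>1 / a\<close>. On the interval it lies between its two end values, so the sum of their
    absolute values bounds it.\<close>
  define K where "K = \<bar>xi a (1/2)\<bar> + \<bar>xi a (-1/2)\<bar>"
  have mono: "xi a y \<le> xi a x" if "-1 < y" "y \<le> x" "x < 1" for x y
    using has_integral_nonneg[OF xi_diff[OF cont pos that]] pos that by (force intro: less_imp_le)
  have K: "\<forall>y\<in>{-1/2..1/2}. \<bar>xi a y\<bar> \<le> K"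
  proof
    fix y :: real assume "y \<in> {-1/2..1/2}"
    then show "\<bar>xi a y\<bar> \<le> K"
      using mono[of "-1/2" y] mono[of y "1/2"] by (auto simp: K_def)
  qed
  define r where "r = p / (4 - p)"
  have r: "r > 0" "(1 + \<theta>) / (3 - \<theta>) = r" using p by (simp_all add: r_def p_def)
  have xim: "xi a \<in> borel_measurable leb_I" and xii: "integrable leb_I (\<lambda>x. \<bar>xi a x\<bar> powr r)"
    using assms(8) unfolding r(2) by (auto simp: Lp_def)
  have W: "integrable leb_I (\<lambda>x. (\<bar>xi a x\<bar> + K + 1) powr (p / (4 - p)))"
    unfolding r_def[symmetric]
  proof (rule Bochner_Integration.integrable_bound)
    show "integrable leb_I (\<lambda>x. (2 powr r) * (\<bar>xi a x\<bar> powr r + (K + 1) powr r))"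
      using xii by (intro integrable_mult_right Bochner_Integration.integrable_add integrable_const_lebesgue_on_Ioo)
    show "(\<lambda>x. (\<bar>xi a x\<bar> + K + 1) powr r) \<in> borel_measurable leb_I"
      using xim by measurable
    show "AE x in leb_I. norm ((\<bar>xi a x\<bar> + K + 1) powr r) \<le> norm ((2 powr r) * (\<bar>xi a x\<bar> powr r + (K + 1) powr r))"
    proof (rule AE_I2)
      fix x
      have "K + 1 \<ge> 0" by (simp add: K_def)
      \<comment> \<open>A sum is at most twice its maximum, and the power of the maximum is one of
        the two powers on the right.\<close>
      then have "(\<bar>xi a x\<bar> + K + 1) powr r \<le> (2 * max \<bar>xi a x\<bar> (K + 1)) powr r"
        using r(1) by (intro powr_mono2) (auto simp: max_def)
      also have "\<dots> = 2 powr r * max \<bar>xi a x\<bar> (K + 1) powr r" using \<open>K + 1 \<ge> 0\<close> by (simp add: powr_mult)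
      also have "\<dots> \<le> 2 powr r * (\<bar>xi a x\<bar> powr r + (K + 1) powr r)"
        by (intro mult_left_mono) (auto simp: max_def)
      finally show "norm ((\<bar>xi a x\<bar> + K + 1) powr r) \<le> norm ((2 powr r) * (\<bar>xi a x\<bar> powr r + (K + 1) powr r))"
        by simp
    qed
  qed
  define C where "C = 2 * (1 + (LINT x|leb_I. (\<bar>xi a x\<bar> + K + 1) powr (p / (4 - p)))) * (T + 1)"
  have "0 \<le> (LINT x|leb_I. (\<bar>xi a x\<bar> + K + 1) powr (p / (4 - p)))"
    by (intro integral_nonneg_AE AE_I2) auto
  then have C0: "C > 0"
    using \<open>T > 0\<close> unfolding C_def by (intro mult_pos_pos add_pos_nonneg) auto
  note bound = B_powr_integral[OF cont pos \<open>T > 0\<close> _ K p W, folded C_def]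
  have Lp: "u \<in> Lp p (lebesgue_on (Q T))" if u: "u \<in> B a T" for u
  proof -
    have m: "u \<in> borel_measurable (lebesgue_on (Q T))" using u by (simp add: B_def)
    \<comment> \<open>An admissible positive \<open>M\<close>; membership only asks for a finite
      bound.\<close>
    have "B_norm a T u + 1 > 0" using B_slices(5)[OF pos \<open>T > 0\<close> u] by simp
    from bound[OF u this] have "(\<integral>\<^sup>+z. ennreal (\<bar>u z\<bar> powr p) \<partial>lebesgue_on (Q T)) < \<infinity>"
      by (auto simp: le_less_trans)
    then have "integrable (lebesgue_on (Q T)) (\<lambda>z. \<bar>u z\<bar> powr p)"
      using m by (intro integrableI_nonneg) auto
    then show ?thesis using m by (simp add: Lp_def)
  qed
  have norm: "Lp_norm p (lebesgue_on (Q T)) u \<le> C powr (1 / p) * B_norm a T u" if u: "u \<in> B a T" for u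
  proof -
    \<comment> \<open>Proved for every \<open>M\<close> above the norm; \<open>dense_ge\<close> then
      passes to the norm itself, including the case where it is 0.\<close>
    have "Lp_norm p (lebesgue_on (Q T)) u \<le> C powr (1 / p) * M" if M: "B_norm a T u < M" for M
    proof -
      have M0: "M > 0" using B_slices(5)[OF pos \<open>T > 0\<close> u] M by simp
      have "ennreal (LINT z|lebesgue_on (Q T). \<bar>u z\<bar> powr p) = (\<integral>\<^sup>+z. ennreal (\<bar>u z\<bar> powr p) \<partial>lebesgue_on (Q T))"
        using Lp[OF u] by (intro nn_integral_eq_integral[symmetric]) (auto simp: Lp_def)
      also have "\<dots> \<le> ennreal (C * M powr p)" using bound[OF u M0] M by simp
      finally have "(LINT z|lebesgue_on (Q T). \<bar>u z\<bar> powr p) \<le> C * M powr p"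
        using C0 by (subst (asm) ennreal_le_iff) auto
      then have "Lp_norm p (lebesgue_on (Q T)) u \<le> (C * M powr p) powr (1 / p)"
        unfolding Lp_norm_def using p by (intro powr_mono2 integral_nonneg_AE AE_I2) auto
      also have "\<dots> = C powr (1 / p) * M"
        using C0 M0 p by (simp add: powr_mult powr_powr)
      finally show ?thesis .
    qed
    then have "Lp_norm p (lebesgue_on (Q T)) u / C powr (1 / p) \<le> M" if "B_norm a T u < M" for M
      using that C0 by (simp add: divide_le_eq mult.commute)
    then have "Lp_norm p (lebesgue_on (Q T)) u / C powr (1 / p) \<le> B_norm a T u"
      by (rule dense_ge)
    then show ?thesis using C0 by (simp add: divide_le_eq mult.commute)
  qed
  \<comment> \<open>The constant may depend on \<open>T\<close>, so the prescribed power of \<open>T\<close> can be divided out.\<close>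
  define c where "c = C powr (1 / p) / T powr ((3 - \<theta>) / (4 * (1 + \<theta>)))"
  have "c > 0" using C0 \<open>T > 0\<close> by (simp add: c_def)
  have "c * T powr ((3 - \<theta>) / (4 * (1 + \<theta>))) = C powr (1 / p)"
    using \<open>T > 0\<close> by (simp add: c_def)
  with norm have "\<forall>u\<in>B a T. Lp_norm p (lebesgue_on (Q T)) u
      \<le> c * T powr ((3 - \<theta>) / (4 * (1 + \<theta>))) * B_norm a T u"
    by simp
  with Lp \<open>c > 0\<close> show ?thesis
    unfolding p_def[symmetric] by (intro conjI exI[of _ c] subsetI)
qed

end
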